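(* Let $K$ be a field, $S=K[x_1,\ldots,x_n]$, and let $I\subset S$ be a nonzero proper monomial ideal. Let $I=\bigcap_{i=1}^s Q_i$ be an irredundant decomposition of $I$ as an intersection of irreducible monomial ideals, and put $P_i=\sqrt{Q_i}$. Then $$\operatorname{sdepth}_S I\ \geq\ \operatorname{size}_S I+1 .$$
   Context: Stanley depth: let $I\supsetneq J$ be monomial ideals of $S$. For a monomial $u\in I\setminus J$ and a subset $Z\subset\{x_1,\ldots,x_n\}$ with $(J:u)\cap K[Z]=0$, let $uK[Z]$ denote the $K$-linear subspace of $I/J$ generated by the elements $uf$, $f\in K[Z]$. A Stanley decomposition of $I/J$ is a presentation $\mathcal D:\ I/J=\bigoplus_{i=1}^r u_iK[Z_i]$ as a finite direct sum of such subspaces; $\operatorname{sdepth}(\mathcal D)=\min_i |Z_i|$, and $\operatorname{sdepth}_S I/J$ is the maximum of $\operatorname{sdepth}(\mathcal D)$ over all Stanley decompositions $\mathcal D$ of $I/J$. For $\operatorname{sdepth}_S I$ take $J=0$. Size: let $a=\sum_{P\in\operatorname{Ass}_S S/I}P$, let $h=\operatorname{height}(a)$, and let $r$ be the minimal $t$ such that there exist $P_1,\ldots,P_t\in\operatorname{Ass}_S S/I$ with $\sum_{i=1}^tP_i=a$. Then $\operatorname{size}_S I=n-h+r-1$. An irreducible monomial ideal is an ideal generated by powers of some of the variables. (The set of associated primes of $S/I$ equals $\{P_1,\ldots,P_s\}$.) *)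

theory Defs
  imports
    "HOL-Library.Poly_Mapping"
    "HOL-Library.Extended_Real"
    "HOL-Library.FuncSet"
    "HOL-Library.Cardinality"
begin

section \<open>Ideals of a commutative ring\<close>

text \<open>An ideal is a submodule of the ring regarded as a module over itself.\<close>

abbreviation ideal :: "'a::comm_ring_1 set \<Rightarrow> bool" where
  "ideal \<equiv> module.subspace (*)"

abbreviation ideal_generated :: "'a::comm_ring_1 set \<Rightarrow> 'a set" where
  "ideal_generated \<equiv> module.span (*)"

definition prime_ideal :: "'a::comm_ring_1 set \<Rightarrow> bool" where
  "prime_ideal P \<longleftrightarrow>
    ideal P \<and> P \<noteq> UNIV \<and> (\<forall>f g. f * g \<in> P \<longrightarrow> f \<in> P \<or> g \<in> P)"

definition radical :: "'a::comm_ring_1 set \<Rightarrow> 'a set" where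
  "radical I = {f. \<exists>m. f ^ m \<in> I}"

definition colon :: "'a::comm_ring_1 set \<Rightarrow> 'a \<Rightarrow> 'a set" where
  "colon I u = {f. f * u \<in> I}"

text \<open>The associated primes of the quotient module \<open>S / I\<close>: the annihilator of the
  class of \<open>u\<close> in \<open>S / I\<close> is \<open>(I : u)\<close>.\<close>

definition Ass :: "'a::comm_ring_1 set \<Rightarrow> 'a set set" where
  "Ass I = {P. prime_ideal P \<and> (\<exists>u. P = colon I u)}"

text \<open>The sum of a family of ideals is the ideal generated by their union; in this form
  it makes sense without knowing that the family is finite.\<close>

definition ideal_sum :: "'a::comm_ring_1 set set \<Rightarrow> 'a set" where
  "ideal_sum F = ideal_generated (\<Union>F)"

definition prime_height :: "'a::comm_ring_1 set \<Rightarrow> enat" where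
  "prime_height P = Sup {enat m | m. \<exists>C :: nat \<Rightarrow> 'a set.
    (\<forall>i\<le>m. prime_ideal (C i)) \<and> (\<forall>i<m. C i \<subset> C (Suc i)) \<and> C m = P}"

definition height :: "'a::comm_ring_1 set \<Rightarrow> enat" where
  "height I = Inf (prime_height ` {P. prime_ideal P \<and> I \<subseteq> P})"

section \<open>Monomial ideals\<close>

text \<open>The polynomial ring \<open>K[x\<^sub>1,\<dots>,x\<^sub>n]\<close>; the variables are indexed by a finite type
  \<open>'n\<close> with \<open>n = CARD('n)\<close>. A polynomial maps exponent vectors to coefficients.\<close>

type_synonym ('n, 'k) mpoly = "('n \<Rightarrow>\<^sub>0 nat) \<Rightarrow>\<^sub>0 'k"

definition monomial :: "('n \<Rightarrow>\<^sub>0 nat) \<Rightarrow> ('n, 'k::field) mpoly" where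
  "monomial e = Poly_Mapping.single e 1"

definition var :: "'n \<Rightarrow> ('n, 'k::field) mpoly" where
  "var i = monomial (Poly_Mapping.single i 1)"

definition monomial_ideal :: "('n, 'k::field) mpoly set \<Rightarrow> bool" where
  "monomial_ideal I \<longleftrightarrow> (\<exists>M \<subseteq> range monomial. I = ideal_generated M)"

definition irreducible_monomial_ideal :: "('n, 'k::field) mpoly set \<Rightarrow> bool" where
  "irreducible_monomial_ideal Q \<longleftrightarrow>
    (\<exists>A a. (\<forall>i\<in>A. 1 \<le> a i) \<and> Q = ideal_generated ((\<lambda>i. var i ^ a i) ` A))"

section \<open>Stanley depth\<close>

text \<open>The subring \<open>K[Z]\<close> for a set \<open>Z\<close> of variables.\<close>

definition polys_in :: "'n set \<Rightarrow> ('n, 'k::field) mpoly set" where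
  "polys_in Z = {f. \<forall>e \<in> Poly_Mapping.keys f. Poly_Mapping.keys e \<subseteq> Z}"

text \<open>A pair \<open>(u, Z)\<close> in \<open>D\<close> stands for the subspace \<open>uK[Z]\<close> of \<open>I / J\<close>. As
  \<open>(J : u) \<inter> K[Z] = 0\<close>, each element of this subspace is the class of \<open>u * f\<close> for a
  unique \<open>f\<close> in \<open>K[Z]\<close>, so the last clause says that every element of \<open>I / J\<close> is in
  exactly one way a sum of elements of the subspaces. Summands of a direct sum are
  nonzero, hence pairwise different, and a set of pairs suffices in place of a family.\<close>

definition stanley_decomposition ::
  "('n, 'k::field) mpoly set \<Rightarrow> ('n, 'k) mpoly set \<Rightarrow> (('n, 'k) mpoly \<times> 'n set) set \<Rightarrow> bool"
  where
  "stanley_decomposition I J D \<longleftrightarrow> finite D \<and>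
    (\<forall>(u, Z) \<in> D. u \<in> range monomial \<and> u \<in> I - J \<and> colon J u \<inter> polys_in Z = {0}) \<and>
    (\<forall>f\<in>I. \<exists>!c. c \<in> (\<Pi>\<^sub>E p\<in>D. polys_in (snd p)) \<and> f - (\<Sum>p\<in>D. fst p * c p) \<in> J)"

definition sdepth_decomposition :: "(('n, 'k::field) mpoly \<times> 'n set) set \<Rightarrow> nat" where
  "sdepth_decomposition D = Min ((\<lambda>(u, Z). card Z) ` D)"

text \<open>The Stanley depth of \<open>I / J\<close>; the Stanley depth of \<open>I\<close> is \<open>sdepth I {0}\<close>. The set
  below is bounded by the number of variables, so that \<open>Max\<close> is applied to a finite set.\<close>

definition sdepth :: "('n::finite, 'k::field) mpoly set \<Rightarrow> ('n, 'k) mpoly set \<Rightarrow> nat" where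
  "sdepth I J = Max {sdepth_decomposition D | D. stanley_decomposition I J D}"

section \<open>Size\<close>

definition Ass_sum :: "'a::comm_ring_1 set \<Rightarrow> 'a set" where
  "Ass_sum I = ideal_sum (Ass I)"

definition Ass_sum_number :: "'a::comm_ring_1 set \<Rightarrow> nat" where
  "Ass_sum_number I =
    (LEAST t. \<exists>P :: nat \<Rightarrow> 'a set. P ` {1..t} \<subseteq> Ass I \<and> ideal_sum (P ` {1..t}) = Ass_sum I)"

text \<open>Heights are extended natural numbers, so \<open>n - h + r - 1\<close> is formed in the extended
  reals; in particular the subtractions do not truncate.\<close>

definition ideal_size :: "('n::finite, 'k::field) mpoly set \<Rightarrow> ereal" where
  "ideal_size I =
    ereal (real CARD('n)) - ereal_of_enat (height (Ass_sum I))
      + ereal (real (Ass_sum_number I)) - 1"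

end

theory Submission
  imports Defs
begin

text \<open>Write \<open>Q\<^sub>i = (x\<^sub>j ^ a\<^sub>i(j) : j \<in> A\<^sub>i)\<close>. The associated primes of \<open>S / I\<close> are generated by the
  sets \<open>A\<^sub>i\<close> of variables. Hence \<open>h\<close> is the cardinality of their union and \<open>r\<close> the least number
  of sets that cover it, and as any subfamily \<open>G\<close> extends to a cover by adding one set for each
  missing variable, \<open>n - h + r \<le> n - |\<Union>G| + |G|\<close> for every subfamily \<open>G\<close>.

  In this form the bound survives an induction on \<open>\<Sum>|A\<^sub>i|\<close> that builds a Stanley decomposition.
  Choose a variable \<open>x\<close> and, among the components with \<open>x \<in> A\<^sub>i\<close>, one with \<open>a\<^sub>i(x)\<close> maximal.
  The monomials of \<open>I\<close> that remain in \<open>Q\<^sub>i\<close> when the generator \<open>x ^ a\<^sub>i(x)\<close> is deleted form an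
  ideal of the same kind with \<open>x\<close> removed from \<open>A\<^sub>i\<close>. The others have one of finitely many
  exponents \<open>c\<close> on \<open>A\<^sub>i - {x}\<close> and are divisible by \<open>x ^ a\<^sub>i(x)\<close>, so they satisfy all components
  involving \<open>x\<close>; for each \<open>c\<close> they form an ideal in the variables outside \<open>A\<^sub>i\<close>, with \<open>x\<close> as an
  additional free variable, which makes up for the component \<open>i\<close> that no longer counts in
  \<open>|G|\<close>.\<close>

section \<open>Partitions into cones\<close>

text \<open>A pair \<open>(A, a)\<close> stands for the irreducible ideal generated by the powers \<open>x\<^sub>j ^ a(j)\<close>
  with \<open>j \<in> A\<close>, and a pair \<open>(u, Z)\<close> for the subspace \<open>uK[Z]\<close>; both are described by the
  exponents of the monomials that they contain.\<close>

definition irr_exps :: "'n set \<times> ('n \<Rightarrow> nat) \<Rightarrow> ('n \<Rightarrow> nat) set" where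
  "irr_exps p = {e. \<exists>j\<in>fst p. snd p j \<le> e j}"

definition cone :: "('n \<Rightarrow> nat) \<times> 'n set \<Rightarrow> ('n \<Rightarrow> nat) set" where
  "cone p = {e. (\<forall>j. fst p j \<le> e j) \<and> (\<forall>j. j \<notin> snd p \<longrightarrow> e j = fst p j)}"

text \<open>This is the combinatorial form of a Stanley decomposition.\<close>

definition cone_partition :: "(('n \<Rightarrow> nat) \<times> 'n set) set \<Rightarrow> ('n \<Rightarrow> nat) set \<Rightarrow> bool" where
  "cone_partition D M \<longleftrightarrow>
    finite D \<and> (\<forall>p\<in>D. cone p \<subseteq> M) \<and> (\<forall>e\<in>M. \<exists>!p. p \<in> D \<and> e \<in> cone p)"

lemma cone_self: "fst p \<in> cone p"
  by (simp add: cone_def)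

lemma cone_partition_Un:
  assumes "cone_partition D M" "cone_partition E N" "M \<inter> N = {}"
  shows "cone_partition (D \<union> E) (M \<union> N)"
  using assms unfolding cone_partition_def
  by (smt (verit, del_insts) UnE UnI1 UnI2 disjoint_iff finite_UnI subset_iff)

text \<open>The predicate \<open>R\<close> will carry the lower bound on the dimensions of the
  cones.\<close>

lemma cone_partition_UN:
  assumes "finite C" "\<And>c. c \<in> C \<Longrightarrow> \<exists>D. cone_partition D (M c) \<and> (\<forall>p\<in>D. R p)"
    and "\<And>c c'. c \<in> C \<Longrightarrow> c' \<in> C \<Longrightarrow> c \<noteq> c' \<Longrightarrow> M c \<inter> M c' = {}"
  shows "\<exists>D. cone_partition D (\<Union>c\<in>C. M c) \<and> (\<forall>p\<in>D. R p)"
  using assms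
proof (induction C rule: finite_induct)
  case empty
  show ?case by (rule exI[of _ "{}"]) (simp add: cone_partition_def)
next
  case (insert c C)
  obtain D where D: "cone_partition D (\<Union>c\<in>C. M c)" "\<forall>p\<in>D. R p"
    using insert.IH insert.prems by auto
  obtain E where E: "cone_partition E (M c)" "\<forall>p\<in>E. R p"
    using insert.prems(1)[of c] by auto
  have "M c \<inter> (\<Union>c\<in>C. M c) = {}"
    using insert.hyps insert.prems(2) by fastforce
  then have "cone_partition (E \<union> D) (M c \<union> (\<Union>c\<in>C. M c))"
    using cone_partition_Un D(1) E(1) by blast
  then show ?case
    using D(2) E(2) by (intro exI[of _ "E \<union> D"]) auto
qed

text \<open>The vertex \<open>b\<close> and the set \<open>V\<close> of free variables vary because
  the recursion freezes coordinates. The bound over all subfamilies still makes sense for families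
  that have become redundant or contain components without generators.\<close>

lemma cone_partition_Inter_irr_exps:
  fixes V :: "'n::finite set"
  assumes "finite F" "\<And>p. p \<in> F \<Longrightarrow> fst p \<subseteq> V"
    and "\<And>G. G \<subseteq> F \<Longrightarrow> d + card (\<Union> (fst ` G)) \<le> card V + card G"
  shows "\<exists>D. cone_partition D (cone (b, V) \<inter> \<Inter> (irr_exps ` F)) \<and> (\<forall>p\<in>D. d \<le> card (snd p))"
  using assms
proof (induction "\<Sum>p\<in>F. card (fst p)" arbitrary: V b F rule: less_induct)
  case less
  show ?case
  proof (cases "\<exists>p\<in>F. fst p \<noteq> {}")
    \<comment> \<open>No component has a generator left: the intersection is the whole cone if there
      are no components, and empty otherwise.\<close>
    case False
    show ?thesis
    proof (cases "F = {}")
      case True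
      then have "cone_partition {(b, V)} (cone (b, V) \<inter> \<Inter> (irr_exps ` F))"
        by (auto simp: cone_partition_def)
      moreover have "d \<le> card V"
        using less.prems(3)[of "{}"] by simp
      ultimately show ?thesis
        by (intro exI[of _ "{(b, V)}"]) simp
    next
      assume "F \<noteq> {}"
      then have "\<Inter> (irr_exps ` F) = {}"
        using False by (fastforce simp: irr_exps_def)
      then show ?thesis
        by (intro exI[of _ "{}"]) (simp add: cone_partition_def)
    qed
  next
    case True
    then obtain x where x: "{p \<in> F. x \<in> fst p} \<noteq> {}" by blast
    obtain p where p: "p \<in> F" "x \<in> fst p"
      and p_max: "\<And>q. q \<in> F \<Longrightarrow> x \<in> fst q \<Longrightarrow> snd q x \<le> snd p x"
    proof (rule obtains_MAX[of "{p \<in> F. x \<in> fst p}" "\<lambda>p. snd p x"])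
      fix p assume p: "p \<in> {p \<in> F. x \<in> fst p}" "Max ((\<lambda>p. snd p x) ` {p \<in> F. x \<in> fst p}) = snd p x"
      show thesis
      proof (rule that)
        show "snd q x \<le> snd p x" if "q \<in> F" "x \<in> fst q" for q
          unfolding p(2)[symmetric] using that less.prems(1) by (intro Max_ge) auto
      qed (use p(1) in auto)
    qed (use less.prems(1) x in auto)
    define A where "A = fst p"
    define a where "a = snd p"
    note xA = p(2)[folded A_def]
    have AV: "A \<subseteq> V" using less.prems(2) p(1) by (auto simp: A_def)

    \<comment> \<open>The monomials that survive the deletion of the generator at
      \<open>x\<close>\<close>
    define p' where "p' = (A - {x}, a)"
    define F' where "F' = insert p' (F - {p})"
    \<comment> \<open>The member \<open>p'\<close> may already occur in \<open>F - {p}\<close>,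
      hence an inequality.\<close>
    have "sum (card \<circ> fst) F' \<le> card (A - {x}) + (\<Sum>q\<in>F - {p}. card (fst q))"
      unfolding F'_def p'_def using less.prems(1) by (simp add: sum.insert_if)
    also have "\<dots> < card A + (\<Sum>q\<in>F - {p}. card (fst q))"
      using xA by (intro add_strict_right_mono card_Diff1_less) simp_all
    also have "\<dots> = (\<Sum>q\<in>F. card (fst q))"
      using p(1) less.prems(1) by (simp add: sum.remove A_def)
    finally have less': "(\<Sum>q\<in>F'. card (fst q)) < (\<Sum>q\<in>F. card (fst q))"
      by (simp add: o_def)
    have bound': "d + card (\<Union> (fst ` G)) \<le> card V + card G" if G: "G \<subseteq> F'" for G
    proof (cases "G \<subseteq> F")
      case True
      then show ?thesis using less.prems(3) by blast
    next
      \<comment> \<open>Exchange \<open>p'\<close> for \<open>p\<close>: the number of members is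
        kept, and the union of the sets of variables can only grow.\<close>
      case False
      define H where "H = G - {p'}"
      have H: "H \<subseteq> F" "p' \<in> G" "p \<notin> H" "p' \<notin> H"
        using G False unfolding F'_def H_def by blast+
      have "finite H" using H(1) less.prems(1) by (rule finite_subset)
      have "d + card (\<Union> (fst ` insert p H)) \<le> card V + card (insert p H)"
        using H(1) p(1) by (intro less.prems(3)) auto
      moreover have G_eq: "G = insert p' H" using H(2) unfolding H_def by blast
      moreover have "\<Union> (fst ` insert p' H) \<subseteq> \<Union> (fst ` insert p H)"
        unfolding p'_def A_def by auto
      then have "card (\<Union> (fst ` G)) \<le> card (\<Union> (fst ` insert p H))"
        unfolding G_eq by (intro card_mono) simp_all
      ultimately show ?thesis using H \<open>finite H\<close> by simp
    qed
    have fin': "finite F'" using less.prems(1) by (simp add: F'_def)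
    have sub': "fst q \<subseteq> V" if "q \<in> F'" for q
      using that less.prems(2)[of q] AV by (auto simp: F'_def p'_def)
    obtain D where D: "cone_partition D (cone (b, V) \<inter> \<Inter> (irr_exps ` F'))"
      "\<forall>q\<in>D. d \<le> card (snd q)"
      using less.hyps[OF less' fin' sub' bound', of b] by blast

    \<comment> \<open>The other monomials, sorted by their exponents on
      \<open>A - {x}\<close>\<close>
    define C where "C = {c. (\<forall>j\<in>A - {x}. b j \<le> c j \<and> c j < a j) \<and> (\<forall>j. j \<notin> A - {x} \<longrightarrow> c j = b j)}"
    have "finite C"
    proof (rule finite_subset)
      show "C \<subseteq> Pi UNIV (\<lambda>j. {..a j + b j})" by (fastforce simp: C_def intro: less_imp_le trans_le_add1)
      show "finite (Pi UNIV (\<lambda>j. {..a j + b j}))"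
        using finite_PiE[of UNIV "\<lambda>j. {..a j + b j}"] by (simp add: PiE_def)
    qed
    define V' where "V' = insert x (V - A)"
    \<comment> \<open>Components involving \<open>x\<close> hold by maximality of
      \<open>a x\<close>, and those with \<open>snd q j \<le> c j\<close> for some
      \<open>j \<in> A\<close> hold by \<open>c\<close>. The rest can be satisfied only through
      variables outside \<open>A\<close>.\<close>
    define Fc where "Fc c = (\<lambda>q. (fst q - A, snd q)) ` {q \<in> F. x \<notin> fst q \<and> (\<forall>j\<in>fst q \<inter> A. c j < snd q j)}" for c
    \<comment> \<open>The maximum combines the bound \<open>b x\<close> of the given cone with
      divisibility by the generator at \<open>x\<close>.\<close>
    define M where "M c = cone (c(x := max (b x) (a x)), V') \<inter> \<Inter> (irr_exps ` Fc c)" for c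
    have part: "\<exists>D. cone_partition D (M c) \<and> (\<forall>p\<in>D. d \<le> card (snd p))" if "c \<in> C" for c
      unfolding M_def
    proof (rule less.hyps)
      let ?F = "{q \<in> F. x \<notin> fst q \<and> (\<forall>j\<in>fst q \<inter> A. c j < snd q j)}"
      have "(\<Sum>q\<in>Fc c. card (fst q)) \<le> (\<Sum>q\<in>?F. card (fst q - A))"
        unfolding Fc_def using less.prems(1) sum_image_le[of ?F "\<lambda>q. card (fst q)" "\<lambda>q. (fst q - A, snd q)"]
        by (simp add: o_def)
      also have "\<dots> \<le> (\<Sum>q\<in>?F. card (fst q))"
        by (intro sum_mono card_mono) auto
      also have "\<dots> \<le> (\<Sum>q\<in>F - {p}. card (fst q))"
        using less.prems(1) p(2) by (intro sum_mono2) auto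
      also have "\<dots> < (\<Sum>q\<in>F. card (fst q))"
        using p less.prems(1) by (simp add: sum.remove[of F p] card_gt_0_iff) blast
      finally show "(\<Sum>q\<in>Fc c. card (fst q)) < (\<Sum>q\<in>F. card (fst q))" .
      show "finite (Fc c)" using less.prems(1) by (simp add: Fc_def)
      show "fst q \<subseteq> V'" if "q \<in> Fc c" for q
        using that less.prems(2) unfolding Fc_def V'_def by fastforce
      show "d + card (\<Union> (fst ` G)) \<le> card V' + card G" if G: "G \<subseteq> Fc c" for G
      proof -
        \<comment> \<open>Removing \<open>A\<close> may identify components, so \<open>H\<close>
          picks one preimage for each member of \<open>G\<close>. In the bound for
          \<open>insert p H\<close>, cancel \<open>card A\<close> on both sides; the extra 1 from
          counting \<open>p\<close> is the variable \<open>x\<close> in \<open>V'\<close>.\<close>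
        obtain H where H: "H \<subseteq> ?F" "inj_on (\<lambda>q. (fst q - A, snd q)) H"
          "G = (\<lambda>q. (fst q - A, snd q)) ` H"
          using G unfolding Fc_def subset_image_inj by blast
        have cG: "card G = card H" using H by (simp add: card_image)
        have UG: "\<Union> (fst ` G) = \<Union> (fst ` H) - A" unfolding H(3) by auto
        have "p \<notin> H" "finite H" using H(1) p(2) less.prems(1) by (auto intro: finite_subset)
        then have "card (insert p H) = Suc (card H)" by simp
        moreover have "d + card (\<Union> (fst ` insert p H)) \<le> card V + card (insert p H)"
          using H(1) p(1) by (intro less.prems(3)) auto
        moreover have "\<Union> (fst ` insert p H) = A \<union> \<Union> (fst ` G)"
          unfolding UG by (auto simp: A_def)
        moreover have "card (A \<union> \<Union> (fst ` G)) = card A + card (\<Union> (fst ` G))"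
          unfolding UG by (rule card_Un_disjoint) auto
        moreover have "card V' = Suc (card V - card A)"
          unfolding V'_def using xA AV by (simp add: card_Diff_subset)
        moreover have "card A \<le> card V" using AV by (simp add: card_mono)
        ultimately show ?thesis using cG by simp
      qed
    qed
    have disj: "M c \<inter> M c' = {}" if cc: "c \<in> C" "c' \<in> C" "c \<noteq> c'" for c c'
    proof -
      \<comment> \<open>Members of \<open>C\<close> agree with \<open>b\<close> outside
        \<open>A - {x}\<close>, so two of them differ at a coordinate that is frozen in both
        cones.\<close>
      obtain j where "c j \<noteq> c' j" using cc(3) by blast
      moreover from this have "j \<in> A - {x}"
        using cc(1,2) unfolding C_def by (metis (mono_tags, lifting) mem_Collect_eq)
      ultimately show ?thesis by (force simp: M_def cone_def V'_def)
    qed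
    obtain E where E: "cone_partition E (\<Union>c\<in>C. M c)" "\<forall>q\<in>E. d \<le> card (snd q)"
      using cone_partition_UN[of C M "\<lambda>q. d \<le> card (snd q)"] \<open>finite C\<close> part disj by blast

    \<comment> \<open>Complementarity of the two parts\<close>
    have M_iff: "e \<in> (\<Union>c\<in>C. M c) \<longleftrightarrow> e \<in> cone (b, V) \<inter> \<Inter> (irr_exps ` F) \<and> e \<notin> irr_exps p'" for e
    proof
      assume "e \<in> (\<Union>c\<in>C. M c)"
      then obtain c where c: "c \<in> C" "e \<in> M c" by blast
      have ex: "b x \<le> e x" "a x \<le> e x"
        using c(2) by (auto simp: M_def cone_def dest!: spec[of _ x])
      have ec: "e j = c j" if "j \<in> A - {x}" for j
        using c(2) that by (force simp: M_def cone_def V'_def)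
      have "b j \<le> e j \<and> (j \<notin> V \<longrightarrow> e j = b j)" for j
      proof (cases "j \<in> A")
        case True
        then show ?thesis using ex ec c(1) AV by (cases "j = x") (auto simp: C_def)
      next
        case False
        then have "c j = b j" "j \<noteq> x" using c(1) xA by (auto simp: C_def)
        moreover have "c j \<le> e j \<and> (j \<notin> V \<longrightarrow> e j = c j)"
          using c(2) False \<open>j \<noteq> x\<close> by (auto simp: M_def cone_def V'_def split: if_splits)
        ultimately show ?thesis by simp
      qed
      then have "e \<in> cone (b, V)" by (simp add: cone_def)
      moreover have "e \<in> irr_exps q" if q: "q \<in> F" for q
      proof (cases "x \<in> fst q")
        case True
        then show ?thesis using p_max[OF q] ex(2) by (auto simp: irr_exps_def a_def intro!: bexI[of _ x])
      next
        case x: False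
        show ?thesis
        proof (cases "\<forall>j\<in>fst q \<inter> A. c j < snd q j")
          case True
          then have "(fst q - A, snd q) \<in> Fc c" using q x by (auto simp: Fc_def)
          then have "e \<in> irr_exps (fst q - A, snd q)" using c(2) by (auto simp: M_def)
          then show ?thesis by (auto simp: irr_exps_def)
        next
          case False
          then obtain j where j: "j \<in> fst q" "j \<in> A" "snd q j \<le> c j" by (auto simp: not_less)
          then have "j \<noteq> x" using x by blast
          then show ?thesis using ec[of j] j by (auto simp: irr_exps_def intro!: bexI[of _ j])
        qed
      qed
      moreover have "e \<notin> irr_exps p'"
        using ec c(1) by (auto simp: irr_exps_def p'_def C_def not_le)
      ultimately show "e \<in> cone (b, V) \<inter> \<Inter> (irr_exps ` F) \<and> e \<notin> irr_exps p'" by blast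
    next
      assume e: "e \<in> cone (b, V) \<inter> \<Inter> (irr_exps ` F) \<and> e \<notin> irr_exps p'"
      then have lt: "e j < a j" if "j \<in> A - {x}" for j
        using that by (auto simp: irr_exps_def p'_def not_le)
      have eV: "b j \<le> e j" "j \<notin> V \<Longrightarrow> e j = b j" for j
        using e by (auto simp: cone_def)
      \<comment> \<open>Since \<open>e\<close> satisfies \<open>p\<close> but not \<open>p'\<close>,
        only the generator at \<open>x\<close> can divide the monomial.\<close>
      have "e \<in> irr_exps p" using e p(1) by blast
      then obtain j where "j \<in> A" "a j \<le> e j" by (auto simp: irr_exps_def A_def a_def)
      then have ax: "a x \<le> e x" using lt[of j] by (cases "j = x") auto
      define c where "c j = (if j \<in> A - {x} then e j else b j)" for j
      have "c \<in> C" using lt eV by (simp add: C_def c_def)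
      moreover have "e \<in> M c"
      proof -
        have "e \<in> cone (c(x := max (b x) (a x)), V')"
          using eV ax by (auto simp: cone_def c_def V'_def)
        moreover have "e \<in> irr_exps (fst q - A, snd q)"
          if q: "q \<in> F" "x \<notin> fst q" "\<forall>j\<in>fst q \<inter> A. c j < snd q j" for q
        proof -
          obtain j where j: "j \<in> fst q" "snd q j \<le> e j"
            using e q(1) by (auto simp: irr_exps_def)
          have "j \<notin> A"
          proof
            assume "j \<in> A"
            then have "c j = e j" using q(2) j(1) by (auto simp: c_def)
            then show False using q(3) j \<open>j \<in> A\<close> by (metis IntI not_le)
          qed
          then show ?thesis using j by (auto simp: irr_exps_def)
        qed
        ultimately show ?thesis by (auto simp: M_def Fc_def)
      qed
      ultimately show "e \<in> (\<Union>c\<in>C. M c)" by blast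
    qed
    have sub: "irr_exps p' \<subseteq> irr_exps p"
      by (auto simp: irr_exps_def p'_def A_def a_def)
    \<comment> \<open>As \<open>p'\<close> is contained in \<open>p\<close>, replacing
      \<open>p\<close> by \<open>p'\<close> amounts to intersecting with
      \<open>irr_exps p'\<close>.\<close>
    have F': "\<Inter> (irr_exps ` F') = \<Inter> (irr_exps ` F) \<inter> irr_exps p'"
      using sub by (auto simp: F'_def)
    have "cone_partition (D \<union> E) (cone (b, V) \<inter> \<Inter> (irr_exps ` F') \<union> (\<Union>c\<in>C. M c))"
      using D(1) E(1) M_iff F' by (intro cone_partition_Un) blast+
    also have "cone (b, V) \<inter> \<Inter> (irr_exps ` F') \<union> (\<Union>c\<in>C. M c) = cone (b, V) \<inter> \<Inter> (irr_exps ` F)"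
      using M_iff unfolding F' by blast
    finally show ?thesis using D(2) E(2) by blast
  qed
qed

section \<open>Subspaces spanned by monomials\<close>

interpretation ring_module: module "(*) :: 'a::comm_ring_1 \<Rightarrow> 'a \<Rightarrow> 'a"
  by unfold_locales (simp_all add: algebra_simps)

abbreviation "lookup \<equiv> Poly_Mapping.lookup"

abbreviation "keys \<equiv> Poly_Mapping.keys"

text \<open>This is the \<open>K\<close>-span of the monomials with exponents in \<open>M\<close>.
  Plain functions serve as exponents, to match the combinatorial part.\<close>

definition supported_on :: "('n \<Rightarrow> nat) set \<Rightarrow> ('n, 'k::field) mpoly set" where
  "supported_on M = {f. \<forall>e\<in>keys f. lookup e \<in> M}"

definition exps_upset :: "('n \<Rightarrow> nat) set \<Rightarrow> bool" where
  "exps_upset M \<longleftrightarrow> (\<forall>e e'. e \<in> M \<longrightarrow> (\<forall>j. e j \<le> e' j) \<longrightarrow> e' \<in> M)"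

text \<open>With an explicit finite index set, a coefficient of a product is found by determining
  which pairs of keys contribute.\<close>

lemma lookup_mult_keys:
  fixes f g :: "('n, 'k::field) mpoly"
  shows "lookup (f * g) k =
    (\<Sum>(a, b)\<in>{(a, b). a \<in> keys f \<and> b \<in> keys g \<and> a + b = k}.
      lookup f a * lookup g b)"
proof -
  have eq: "{(a, b). a \<in> keys f \<and> b \<in> keys g \<and> a + b = k}
    = {(a, b). (lookup f a * lookup g b when k = a + b) \<noteq> 0}"
    by (auto simp: in_keys_iff when_def)
  have "lookup (f * g) k = (\<Sum>(a, b). lookup f a * lookup g b when k = a + b)"
    unfolding times_poly_mapping.rep_eq by (rule prod_fun_unfold_prod) simp_all
  also have "\<dots> = (\<Sum>(a, b)\<in>{(a, b). a \<in> keys f \<and> b \<in> keys g \<and> a + b = k}.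
      lookup f a * lookup g b when k = a + b)"
    unfolding Sum_any.expand_set eq by (intro sum.cong) auto
  also have "\<dots> = (\<Sum>(a, b)\<in>{(a, b). a \<in> keys f \<and> b \<in> keys g \<and> a + b = k}.
      lookup f a * lookup g b)"
    by (intro sum.cong) auto
  finally show ?thesis .
qed

lemma keys_monomial [simp]: "keys (monomial e :: ('n, 'k::field) mpoly) = {e}"
  by (simp add: monomial_def)

lemma lookup_monomial: "lookup (monomial e :: ('n, 'k::field) mpoly) k = (if k = e then 1 else 0)"
  by (auto simp: monomial_def lookup_single when_def)

lemma lookup_monomial_mult_add [simp]:
  "lookup (monomial u * f :: ('n, 'k::field) mpoly) (u + e) = lookup f e"
proof -
  have "{(a, b). a \<in> keys (monomial u :: ('n, 'k) mpoly) \<and> b \<in> keys f \<and> a + b = u + e}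
    = (if e \<in> keys f then {(u, e)} else {})"
    by auto
  then show ?thesis
    by (auto simp: lookup_mult_keys lookup_monomial in_keys_iff)
qed

lemma lookup_monomial_mult_eq_0:
  assumes "\<And>e. k \<noteq> u + e"
  shows "lookup (monomial u * f :: ('n, 'k::field) mpoly) k = 0"
proof -
  have "{(a, b). a \<in> keys (monomial u :: ('n, 'k) mpoly) \<and> b \<in> keys f \<and> a + b = k} = {}"
    using assms by auto
  then show ?thesis unfolding lookup_mult_keys by (simp only: sum.empty)
qed

lemma monomial_mult_eq_0_iff [simp]:
  "monomial u * f = (0 :: ('n, 'k::field) mpoly) \<longleftrightarrow> f = 0"
  by (metis lookup_monomial_mult_add lookup_zero mult_zero_right poly_mapping_eqI)

lemma monomial_add: "monomial (a + b) = monomial a * (monomial b :: ('n, 'k::field) mpoly)"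
  by (simp add: monomial_def mult_single)

lemma var_power: "var i ^ a = (monomial (Poly_Mapping.single i a) :: ('n, 'k::field) mpoly)"
proof (induction a)
  case 0
  show ?case by (simp add: monomial_def single_one)
next
  case (Suc a)
  have "Poly_Mapping.single i (Suc a) = Poly_Mapping.single i 1 + Poly_Mapping.single i a"
    by (simp add: single_add[symmetric])
  then show ?case using Suc by (simp add: var_def monomial_add)
qed

lemma poly_eq_sum_monomials:
  "f = (\<Sum>e\<in>keys f. Poly_Mapping.single 0 (lookup f e) * (monomial e :: ('n, 'k::field) mpoly))"
proof (rule poly_mapping_eqI)
  fix k
  have "lookup (\<Sum>e\<in>keys f. Poly_Mapping.single 0 (lookup f e) * monomial e) k
    = (\<Sum>e\<in>keys f. if e = k then lookup f e else 0)"
    unfolding lookup_sum by (intro sum.cong) (auto simp: monomial_def mult_single lookup_single when_def)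
  then show "lookup f k = lookup (\<Sum>e\<in>keys f. Poly_Mapping.single 0 (lookup f e) * monomial e) k"
    by (simp add: in_keys_iff)
qed

section \<open>Monomial ideals as spans of up-sets of exponents\<close>

lemma ideal_supported_on:
  assumes "exps_upset M"
  shows "ideal (supported_on M :: ('n, 'k::field) mpoly set)"
proof (rule ring_module.subspaceI)
  show "0 \<in> supported_on M" by (simp add: supported_on_def)
  show "f + g \<in> supported_on M" if "f \<in> supported_on M" "g \<in> supported_on M" for f g :: "('n, 'k) mpoly"
    using that keys_add[of f g] unfolding supported_on_def by blast
  show "c * f \<in> supported_on M" if f: "f \<in> supported_on M" for c f :: "('n, 'k) mpoly"
    unfolding supported_on_def
  proof (intro CollectI ballI)
    fix e assume "e \<in> keys (c * f)"
    then obtain a b where ab: "e = a + b" "b \<in> keys f"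
      using keys_mult[of c f] by blast
    then have "lookup b \<in> M" using f by (simp add: supported_on_def)
    then show "lookup e \<in> M"
      using assms unfolding exps_upset_def by (simp add: ab(1) lookup_add)
  qed
qed

lemma poly_mapping_le_diff:
  fixes a b :: "'n \<Rightarrow>\<^sub>0 nat"
  assumes "\<And>j. lookup a j \<le> lookup b j"
  shows "b = a + (b - a)"
  using assms by (intro poly_mapping_eqI) (simp add: lookup_add lookup_minus)

text \<open>The right-hand side is an ideal containing the generators; conversely, each term of its
  elements is a multiple of a generator.\<close>

lemma ideal_generated_monomials:
  "ideal_generated (monomial ` E :: ('n, 'k::field) mpoly set)
    = supported_on {e. \<exists>g\<in>E. \<forall>j. lookup g j \<le> e j}"
proof
  let ?M = "{e. \<exists>g\<in>E. \<forall>j. lookup g j \<le> e j}"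
  have "exps_upset ?M"
    unfolding exps_upset_def by (blast intro: order_trans)
  then have "ideal (supported_on ?M :: ('n, 'k) mpoly set)" by (rule ideal_supported_on)
  moreover have "monomial ` E \<subseteq> (supported_on ?M :: ('n, 'k) mpoly set)"
    by (auto simp: supported_on_def)
  ultimately show "ideal_generated (monomial ` E) \<subseteq> (supported_on ?M :: ('n, 'k) mpoly set)"
    by (intro ring_module.span_minimal)
  show "supported_on ?M \<subseteq> ideal_generated (monomial ` E :: ('n, 'k) mpoly set)"
  proof
    fix f :: "('n, 'k) mpoly" assume f: "f \<in> supported_on ?M"
    have "monomial e \<in> ideal_generated (monomial ` E :: ('n, 'k) mpoly set)"
      if e: "e \<in> keys f" for e
    proof -
      obtain g where g: "g \<in> E" "\<And>j. lookup g j \<le> lookup e j"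
      proof -
        have "lookup e \<in> ?M" using f e unfolding supported_on_def by blast
        then show ?thesis using that by blast
      qed
      have "monomial e = (monomial (g + (e - g)) :: ('n, 'k) mpoly)"
        using poly_mapping_le_diff[OF g(2)] by (rule arg_cong)
      also have "\<dots> = monomial (e - g) * monomial g"
        by (simp only: monomial_add mult.commute)
      finally have "monomial e = monomial (e - g) * (monomial g :: ('n, 'k) mpoly)" .
      then show ?thesis
        using g(1) by (simp only:) (intro ring_module.span_scale[OF ring_module.span_base] imageI)
    qed
    then have "(\<Sum>e\<in>keys f. Poly_Mapping.single 0 (lookup f e) * monomial e)
      \<in> ideal_generated (monomial ` E :: ('n, 'k) mpoly set)"
      by (intro ring_module.span_sum ring_module.span_scale)
    then show "f \<in> ideal_generated (monomial ` E :: ('n, 'k) mpoly set)"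
      using poly_eq_sum_monomials[of f] by simp
  qed
qed

lemma exps_upset_irr_exps: "exps_upset (irr_exps p)"
  unfolding exps_upset_def irr_exps_def by (blast intro: order_trans)

lemma ideal_generated_var_powers:
  "ideal_generated ((\<lambda>i. var i ^ a i) ` A :: ('n, 'k::field) mpoly set) = supported_on (irr_exps (A, a))"
proof -
  have "(\<lambda>i. var i ^ a i) ` A = (monomial ` (\<lambda>i. Poly_Mapping.single i (a i)) ` A :: ('n, 'k) mpoly set)"
    by (auto simp: var_power)
  moreover have "{e. \<exists>g\<in>(\<lambda>i. Poly_Mapping.single i (a i)) ` A. \<forall>j. lookup g j \<le> e j} = irr_exps (A, a)"
    by (auto simp: irr_exps_def lookup_single when_def)
  ultimately show ?thesis by (simp add: ideal_generated_monomials)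
qed

lemma supported_on_INT: "supported_on (\<Inter>i\<in>X. M i) = (\<Inter>i\<in>X. supported_on (M i))"
  by (auto simp: supported_on_def)

section \<open>Stanley decompositions\<close>

text \<open>Each exponent in \<open>M\<close> lies in exactly one cone, so only one summand
  contributes to the coefficient there. Comparing coefficients yields both existence and
  uniqueness.\<close>

lemma stanley_decomposition_of_cone_partition:
  fixes M :: "('n::finite \<Rightarrow> nat) set"
  assumes "cone_partition D M"
  defines "m \<equiv> \<lambda>p. (monomial (Abs_poly_mapping (fst p)), snd p) :: ('n, 'k::field) mpoly \<times> 'n set"
  shows "stanley_decomposition (supported_on M) {0} (m ` D)"
proof -
  have lookup_Abs [simp]: "lookup (Abs_poly_mapping u) = u" for u :: "'n \<Rightarrow> nat"
    by (simp add: Abs_poly_mapping_inverse)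
  have mono_inj: "e = e'" if "(monomial e :: ('n, 'k) mpoly) = monomial e'" for e e' :: "'n \<Rightarrow>\<^sub>0 nat"
    using that by (metis keys_monomial singleton_inject)
  have inj: "inj_on m D"
    by (intro inj_onI) (auto simp: m_def dest!: mono_inj intro!: prod_eqI, metis lookup_Abs)
  have D: "finite D" "\<And>p. p \<in> D \<Longrightarrow> cone p \<subseteq> M" "\<And>e. e \<in> M \<Longrightarrow> \<exists>!p. p \<in> D \<and> e \<in> cone p"
    using assms(1) by (auto simp: cone_partition_def)
  have cone_iff: "lookup e \<in> cone p \<longleftrightarrow> (\<exists>k. e = Abs_poly_mapping (fst p) + k \<and> keys k \<subseteq> snd p)"
    for e and p :: "('n \<Rightarrow> nat) \<times> 'n set"
  proof
    assume e: "lookup e \<in> cone p"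
    then have "e = Abs_poly_mapping (fst p) + (e - Abs_poly_mapping (fst p))"
      by (intro poly_mapping_le_diff) (simp add: cone_def)
    moreover have "keys (e - Abs_poly_mapping (fst p)) \<subseteq> snd p"
      using e by (auto simp: cone_def in_keys_iff lookup_minus)
    ultimately show "\<exists>k. e = Abs_poly_mapping (fst p) + k \<and> keys k \<subseteq> snd p" by blast
  next
    assume "\<exists>k. e = Abs_poly_mapping (fst p) + k \<and> keys k \<subseteq> snd p"
    then show "lookup e \<in> cone p" by (auto simp: cone_def lookup_add in_keys_iff)
  qed
  have fst_m: "fst (m p) = monomial (Abs_poly_mapping (fst p))" for p
    by (simp add: m_def)
  have coeff_outside: "lookup (fst (m p) * c) e = 0"
    if "c \<in> polys_in (snd p)" "lookup e \<notin> cone p"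
    for p :: "('n \<Rightarrow> nat) \<times> 'n set" and c :: "('n, 'k) mpoly" and e
  proof (cases "\<exists>k. e = Abs_poly_mapping (fst p) + k")
    case True
    then obtain k where k: "e = Abs_poly_mapping (fst p) + k" by blast
    then have "k \<notin> keys c"
      using that cone_iff by (auto simp: polys_in_def)
    then show ?thesis by (simp add: k m_def in_keys_iff)
  next
    case False
    then show ?thesis by (auto simp: m_def intro!: lookup_monomial_mult_eq_0)
  qed
  have coeff_inside: "lookup (\<Sum>q\<in>D. fst (m q) * c (m q)) e = lookup (fst (m p) * c (m p)) e"
    if c: "\<And>q. q \<in> D \<Longrightarrow> c (m q) \<in> polys_in (snd q)" and p: "p \<in> D" "lookup e \<in> cone p" for p c e
  proof -
    have "lookup (fst (m q) * c (m q)) e = 0" if "q \<in> D - {p}" for q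
      using D(3)[of "lookup e"] D(2)[of p] p that c by (intro coeff_outside) blast+
    then show ?thesis
      unfolding lookup_sum using p(1) D(1) by (simp add: sum.remove[of D p])
  qed
  have sum_m: "(\<Sum>p\<in>m ` D. fst p * c p) = (\<Sum>q\<in>D. fst (m q) * c (m q))" for c :: "_ \<Rightarrow> ('n, 'k) mpoly"
    using inj by (simp add: sum.reindex)
  show "stanley_decomposition (supported_on M) {0} (m ` D)"
    unfolding stanley_decomposition_def
  proof (intro conjI ballI)
    show "finite (m ` D)" using D(1) by simp
  next
    fix q assume "q \<in> m ` D"
    then obtain p where p: "p \<in> D" "q = m p" by blast
    have "fst p \<in> M" using D(2)[OF p(1)] cone_self by blast
    then have "monomial (Abs_poly_mapping (fst p)) \<in> (supported_on M :: ('n, 'k) mpoly set)"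
      by (simp add: supported_on_def)
    moreover have "monomial u \<noteq> (0 :: ('n, 'k) mpoly)" for u
      by (metis keys_monomial keys_zero insert_not_empty)
    ultimately show "case q of (u, Z) \<Rightarrow> u \<in> range monomial \<and> u \<in> supported_on M - {0} \<and> colon {0} u \<inter> polys_in Z = {0}"
      by (auto simp: p(2) m_def colon_def polys_in_def mult.commute[of _ "monomial _"])
  next
    fix f :: "('n, 'k) mpoly" assume f: "f \<in> supported_on M"
    show "\<exists>!c. c \<in> (\<Pi>\<^sub>E p\<in>m ` D. polys_in (snd p)) \<and> f - (\<Sum>p\<in>m ` D. fst p * c p) \<in> {0}"
    proof (rule ex_ex1I)
      \<comment> \<open>The part of \<open>f\<close> on the cone of \<open>p\<close>, divided by the
        monomial at the vertex.\<close>
      define g where "g p = Abs_poly_mapping (\<lambda>e. if keys e \<subseteq> snd p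
          then lookup f (Abs_poly_mapping (fst p) + e) else 0)" for p :: "('n \<Rightarrow> nat) \<times> 'n set"
      have lookup_g: "lookup (g p) e = (if keys e \<subseteq> snd p
          then lookup f (Abs_poly_mapping (fst p) + e) else 0)" for p e
      proof -
        have "{e. (if keys e \<subseteq> snd p then lookup f (Abs_poly_mapping (fst p) + e) else 0) \<noteq> 0}
          \<subseteq> (\<lambda>k. k - Abs_poly_mapping (fst p)) ` keys f"
        proof
          fix e assume "e \<in> {e. (if keys e \<subseteq> snd p then lookup f (Abs_poly_mapping (fst p) + e) else 0) \<noteq> 0}"
          then have "Abs_poly_mapping (fst p) + e \<in> keys f"
            by (auto simp: in_keys_iff split: if_splits)
          then show "e \<in> (\<lambda>k. k - Abs_poly_mapping (fst p)) ` keys f"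
            by (rule rev_image_eqI) simp
        qed
        then have "finite {e. (if keys e \<subseteq> snd p then lookup f (Abs_poly_mapping (fst p) + e) else 0) \<noteq> 0}"
          by (rule finite_subset) simp
        then show ?thesis unfolding g_def by (simp add: Abs_poly_mapping_inverse)
      qed
      have g_in: "g p \<in> polys_in (snd p)" for p
        unfolding polys_in_def by (intro CollectI ballI) (metis in_keys_iff lookup_g)
      \<comment> \<open>The product is indexed by the image of \<open>D\<close> under
        \<open>m\<close>, hence the inverse of \<open>m\<close>; \<open>restrict\<close> supplies
        the default value that extensionality demands.\<close>
      define c where "c = restrict (g \<circ> inv_into D m) (m ` D)"
      have c_m: "c (m p) = g p" if "p \<in> D" for p
        using that inj by (simp add: c_def)
      have "f = (\<Sum>q\<in>D. fst (m q) * c (m q))"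
      proof (rule poly_mapping_eqI)
        fix e
        show "lookup f e = lookup (\<Sum>q\<in>D. fst (m q) * c (m q)) e"
        proof (cases "lookup e \<in> M")
          case True
          then obtain p where p: "p \<in> D" "lookup e \<in> cone p" using D(3) by blast
          then obtain k where k: "e = Abs_poly_mapping (fst p) + k" "keys k \<subseteq> snd p"
            using cone_iff by blast
          have "lookup (\<Sum>q\<in>D. fst (m q) * c (m q)) e = lookup (fst (m p) * c (m p)) e"
            using p by (intro coeff_inside) (simp_all add: c_m g_in)
          then show ?thesis by (simp add: c_m p(1) k fst_m lookup_g)
        next
          case False
          then have "lookup f e = 0" using f by (auto simp: supported_on_def in_keys_iff)
          moreover have "lookup (fst (m q) * c (m q)) e = 0" if "q \<in> D" for q
            using that D(2)[of q] False by (intro coeff_outside) (auto simp: c_m g_in)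
          ultimately show ?thesis by (simp add: lookup_sum)
        qed
      qed
      moreover have "c \<in> (\<Pi>\<^sub>E p\<in>m ` D. polys_in (snd p))"
        using g_in c_m by (auto simp: c_def m_def)
      ultimately show "\<exists>c. c \<in> (\<Pi>\<^sub>E p\<in>m ` D. polys_in (snd p)) \<and> f - (\<Sum>p\<in>m ` D. fst p * c p) \<in> {0}"
        unfolding sum_m by (intro exI[of _ c]) simp
    next
      fix c c'
      assume c: "c \<in> (\<Pi>\<^sub>E p\<in>m ` D. polys_in (snd p)) \<and> f - (\<Sum>p\<in>m ` D. fst p * c p) \<in> {0}"
        and c': "c' \<in> (\<Pi>\<^sub>E p\<in>m ` D. polys_in (snd p)) \<and> f - (\<Sum>p\<in>m ` D. fst p * c' p) \<in> {0}"
      have in_polys: "c (m p) \<in> polys_in (snd p)" "c' (m p) \<in> polys_in (snd p)" if "p \<in> D" for p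
        using c c' that by (auto simp: PiE_iff m_def)
      have eq: "(\<Sum>q\<in>D. fst (m q) * c (m q)) = (\<Sum>q\<in>D. fst (m q) * c' (m q))"
        using c c' unfolding sum_m by simp
      have "c (m p) = c' (m p)" if p: "p \<in> D" for p
      proof (rule poly_mapping_eqI)
        fix k
        show "lookup (c (m p)) k = lookup (c' (m p)) k"
        proof (cases "keys k \<subseteq> snd p")
          case True
          then have e: "lookup (Abs_poly_mapping (fst p) + k) \<in> cone p" using cone_iff by blast
          have "lookup (fst (m p) * c (m p)) (Abs_poly_mapping (fst p) + k)
            = lookup (fst (m p) * c' (m p)) (Abs_poly_mapping (fst p) + k)"
            using coeff_inside[of c, OF _ p e] coeff_inside[of c', OF _ p e] in_polys eq by simp
          then show ?thesis by (simp add: fst_m)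
        next
          case False
          then have "k \<notin> keys (c (m p))" "k \<notin> keys (c' (m p))"
            using in_polys[OF p] by (auto simp: polys_in_def)
          then show ?thesis by (simp add: in_keys_iff)
        qed
      qed
      then show "c = c'" using c c' by (intro PiE_ext[of c "m ` D" _ c']) auto
    qed
  qed
qed

text \<open>\<open>Min\<close> and \<open>Max\<close> have to range over finite nonempty sets. A
  nonzero element of \<open>I\<close> forces decompositions to be nonempty, and then their depths
  are at most the number of variables.\<close>

lemma sdepth_ge:
  fixes I :: "('n::finite, 'k::field) mpoly set"
  assumes "stanley_decomposition I {0} D" "\<And>p. p \<in> D \<Longrightarrow> d \<le> card (snd p)"
    and "I \<noteq> {0}" "0 \<in> I"
  shows "d \<le> sdepth I {0}"
proof -
  have nonempty: "E \<noteq> {}" "finite E" if "stanley_decomposition I {0} E" for E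
  proof -
    obtain f where "f \<in> I" "f \<noteq> 0" using assms(3,4) by blast
    then show "E \<noteq> {}" "finite E" using that by (fastforce simp: stanley_decomposition_def)+
  qed
  have "sdepth_decomposition E \<le> CARD('n)" if E: "stanley_decomposition I {0} E" for E
  proof -
    obtain p where "p \<in> E" using nonempty[OF E] by blast
    then have "sdepth_decomposition E \<le> card (snd p)"
      unfolding sdepth_decomposition_def using nonempty[OF E]
      by (intro Min_le) (auto simp: case_prod_beta)
    also have "\<dots> \<le> CARD('n)" by (simp add: card_mono)
    finally show ?thesis .
  qed
  then have "{sdepth_decomposition E | E. stanley_decomposition I {0} E} \<subseteq> {..CARD('n)}" by blast
  then have "finite {sdepth_decomposition E | E. stanley_decomposition I {0} E}"
    by (rule finite_subset) simp
  then have "sdepth_decomposition D \<le> sdepth I {0}"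
    unfolding sdepth_def using assms(1) by (intro Max_ge) blast+
  moreover have "d \<le> sdepth_decomposition D"
    unfolding sdepth_decomposition_def using nonempty[OF assms(1)] assms(2)
    by (intro Min.boundedI) auto
  ultimately show ?thesis by simp
qed

section \<open>Associated primes and size\<close>

text \<open>Shrinking both sets, one coordinate after another, to the elements with minimal
  coordinate keeps the property that no other pairs have the same sums.\<close>

lemma unique_sum_of_exponents:
  fixes X Y :: "('n::finite \<Rightarrow>\<^sub>0 nat) set"
  assumes "finite X" "X \<noteq> {}" "finite Y" "Y \<noteq> {}"
  obtains a b where "a \<in> X" "b \<in> Y"
    "\<And>a' b'. a' \<in> X \<Longrightarrow> b' \<in> Y \<Longrightarrow> a' + b' = a + b \<Longrightarrow> a' = a \<and> b' = b"
proof -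
  have "\<exists>X' Y'. X' \<subseteq> X \<and> Y' \<subseteq> Y \<and> X' \<noteq> {} \<and> Y' \<noteq> {} \<and>
    (\<forall>j\<in>J. \<forall>a\<in>X'. \<forall>a'\<in>X'. lookup a j = lookup a' j) \<and>
    (\<forall>j\<in>J. \<forall>b\<in>Y'. \<forall>b'\<in>Y'. lookup b j = lookup b' j) \<and>
    (\<forall>a\<in>X. \<forall>b\<in>Y. \<forall>a'\<in>X'. \<forall>b'\<in>Y'. a + b = a' + b' \<longrightarrow> a \<in> X' \<and> b \<in> Y')" for J :: "'n set"
    using finite[of J]
  proof (induction J rule: finite_induct)
    case empty
    show ?case using assms by blast
  next
    case (insert j J)
    then obtain X' Y' where XY: "X' \<subseteq> X" "Y' \<subseteq> Y" "X' \<noteq> {}" "Y' \<noteq> {}"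
      "\<forall>j\<in>J. \<forall>a\<in>X'. \<forall>a'\<in>X'. lookup a j = lookup a' j"
      "\<forall>j\<in>J. \<forall>b\<in>Y'. \<forall>b'\<in>Y'. lookup b j = lookup b' j"
      "\<forall>a\<in>X. \<forall>b\<in>Y. \<forall>a'\<in>X'. \<forall>b'\<in>Y'. a + b = a' + b' \<longrightarrow> a \<in> X' \<and> b \<in> Y'"
      by blast
    obtain a0 where a0: "a0 \<in> X'" "\<And>a. a \<in> X' \<Longrightarrow> lookup a0 j \<le> lookup a j"
      using ex_has_least_nat[of "\<lambda>a. a \<in> X'" _ "\<lambda>a. lookup a j"] XY(3) by blast
    obtain b0 where b0: "b0 \<in> Y'" "\<And>b. b \<in> Y' \<Longrightarrow> lookup b0 j \<le> lookup b j"
      using ex_has_least_nat[of "\<lambda>b. b \<in> Y'" _ "\<lambda>b. lookup b j"] XY(4) by blast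
    define X'' where "X'' = {a \<in> X'. lookup a j = lookup a0 j}"
    define Y'' where "Y'' = {b \<in> Y'. lookup b j = lookup b0 j}"
    have closed: "a \<in> X'' \<and> b \<in> Y''"
      if "a \<in> X" "b \<in> Y" "a' \<in> X''" "b' \<in> Y''" "a + b = a' + b'" for a b a' b'
    proof -
      have ab: "a \<in> X'" "b \<in> Y'" using XY(7) that unfolding X''_def Y''_def by blast+
      \<comment> \<open>Both coordinates are at least the respective minima and their sum is the sum
        of the minima, so both are minimal.\<close>
      have "lookup a j + lookup b j = lookup a' j + lookup b' j"
        using that(5) by (metis lookup_add)
      then show ?thesis
        using a0(2)[OF ab(1)] b0(2)[OF ab(2)] ab that(3,4) by (auto simp: X''_def Y''_def)
    qed
    show ?case
    proof (rule exI[of _ X''], rule exI[of _ Y''], intro conjI)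
      show "X'' \<subseteq> X" "Y'' \<subseteq> Y" using XY(1,2) by (auto simp: X''_def Y''_def)
      show "X'' \<noteq> {}" "Y'' \<noteq> {}" using a0(1) b0(1) by (auto simp: X''_def Y''_def)
      show "\<forall>j\<in>insert j J. \<forall>a\<in>X''. \<forall>a'\<in>X''. lookup a j = lookup a' j"
        using XY(5) by (auto simp: X''_def)
      show "\<forall>j\<in>insert j J. \<forall>b\<in>Y''. \<forall>b'\<in>Y''. lookup b j = lookup b' j"
        using XY(6) by (auto simp: Y''_def)
      show "\<forall>a\<in>X. \<forall>b\<in>Y. \<forall>a'\<in>X''. \<forall>b'\<in>Y''. a + b = a' + b' \<longrightarrow> a \<in> X'' \<and> b \<in> Y''"
        using closed by blast
    qed
  qed
  from this[of UNIV] obtain X' Y' where XY: "X' \<subseteq> X" "Y' \<subseteq> Y" "X' \<noteq> {}" "Y' \<noteq> {}"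
    "\<forall>j\<in>UNIV. \<forall>a\<in>X'. \<forall>a'\<in>X'. lookup a j = lookup a' j"
    "\<forall>j\<in>UNIV. \<forall>b\<in>Y'. \<forall>b'\<in>Y'. lookup b j = lookup b' j"
    "\<forall>a\<in>X. \<forall>b\<in>Y. \<forall>a'\<in>X'. \<forall>b'\<in>Y'. a + b = a' + b' \<longrightarrow> a \<in> X' \<and> b \<in> Y'"
    by blast
  obtain a b where ab: "a \<in> X'" "b \<in> Y'" using XY(3,4) by blast
  have eq: "a' = a" if "a' \<in> X'" for a' using XY(5) that ab(1) by (intro poly_mapping_eqI) blast
  have eq': "b' = b" if "b' \<in> Y'" for b' using XY(6) that ab(2) by (intro poly_mapping_eqI) blast
  show thesis
  proof (rule that)
    show "a \<in> X" "b \<in> Y" using ab XY(1,2) by blast+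
    show "a' = a \<and> b' = b" if "a' \<in> X" "b' \<in> Y" "a' + b' = a + b" for a' b'
      using XY(7) that ab eq eq' by blast
  qed
qed

text \<open>The ideal generated by the variables in \<open>A\<close>, written with exponents 1 so
  that results on \<open>irr_exps\<close> specialize to it.\<close>

definition var_ideal :: "'n set \<Rightarrow> ('n, 'k::field) mpoly set" where
  "var_ideal A = supported_on (irr_exps (A, \<lambda>_. 1))"

lemma mem_var_ideal: "f \<in> var_ideal A \<longleftrightarrow> (\<forall>e\<in>keys f. \<exists>i\<in>A. lookup e i \<noteq> 0)"
  by (simp add: var_ideal_def supported_on_def irr_exps_def Suc_le_eq)

lemma var_ideal_mono: "A \<subseteq> B \<Longrightarrow> var_ideal A \<subseteq> var_ideal B"
  unfolding mem_var_ideal subset_iff by blast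

lemma var_in_var_ideal_iff [simp]: "(var i :: ('n, 'k::field) mpoly) \<in> var_ideal A \<longleftrightarrow> i \<in> A"
  by (auto simp: mem_var_ideal var_def lookup_single when_def)

lemma ideal_generated_vars: "ideal_generated (var ` A) = (var_ideal A :: ('n, 'k::field) mpoly set)"
  using ideal_generated_var_powers[of "\<lambda>_. 1" A] by (simp add: var_ideal_def)

text \<open>Irreducible monomial ideals are primary. Otherwise \<open>f\<close> has terms free of
  \<open>A\<close> and \<open>u\<close> has terms outside the ideal; a pair of such terms with a
  unique sum gives a term of \<open>f * u\<close> outside the ideal that cannot cancel.\<close>

lemma supported_on_irr_exps_primary:
  fixes f u :: "('n::finite, 'k::field) mpoly"
  assumes "f * u \<in> supported_on (irr_exps (A, a))" "u \<notin> supported_on (irr_exps (A, a))"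
  shows "f \<in> var_ideal A"
proof (rule ccontr)
  assume "f \<notin> var_ideal A"
  define X where "X = {e \<in> keys f. \<forall>i\<in>A. lookup e i = 0}"
  define Y where "Y = {e \<in> keys u. lookup e \<notin> irr_exps (A, a)}"
  define deg where "deg e = (\<Sum>i\<in>A. lookup e i)" for e :: "'n \<Rightarrow>\<^sub>0 nat"
  have "X \<noteq> {}" using \<open>f \<notin> var_ideal A\<close> by (auto simp: X_def mem_var_ideal)
  have "Y \<noteq> {}" using assms(2) by (auto simp: Y_def supported_on_def)
  then obtain e0 where e0: "e0 \<in> Y" "\<And>e. e \<in> Y \<Longrightarrow> deg e0 \<le> deg e"
    using ex_has_least_nat[of "\<lambda>e. e \<in> Y" _ deg] by blast
  \<comment> \<open>Minimal degree in \<open>A\<close> excludes all other pairs: if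
    \<open>b' + c' = b + c\<close> with \<open>c' \<in> Y\<close>, then
    \<open>deg c' = deg e0\<close> and \<open>deg b' = 0\<close>, so
    \<open>b' \<in> X\<close>.\<close>
  define Y0 where "Y0 = {e \<in> Y. deg e = deg e0}"
  have "finite X" "finite Y0" "Y0 \<noteq> {}" using e0(1) by (auto simp: X_def Y_def Y0_def)
  then obtain b c where bc: "b \<in> X" "c \<in> Y0"
    and unique: "\<And>b' c'. b' \<in> X \<Longrightarrow> c' \<in> Y0 \<Longrightarrow> b' + c' = b + c \<Longrightarrow> b' = b \<and> c' = c"
    using unique_sum_of_exponents[of X Y0] \<open>X \<noteq> {}\<close> by blast
  have b0: "lookup b i = 0" if "i \<in> A" for i using bc(1) that by (simp add: X_def)
  have not_in: "lookup (b + c) \<notin> irr_exps (A, a)"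
    using bc(2) b0 by (auto simp: Y0_def Y_def irr_exps_def lookup_add)
  have deg_add: "deg (e + e') = deg e + deg e'" for e e'
    by (simp add: deg_def lookup_add sum.distrib)
  have "{(b', c'). b' \<in> keys f \<and> c' \<in> keys u \<and> b' + c' = b + c} = {(b, c)}" (is "?S = _")
  proof (intro equalityI subsetI)
    fix z assume "z \<in> ?S"
    then obtain b' c' where z: "z = (b', c')" "b' \<in> keys f" "c' \<in> keys u" "b' + c' = b + c" by blast
    have "lookup c' \<notin> irr_exps (A, a)"
    proof
      assume "lookup c' \<in> irr_exps (A, a)"
      then have "lookup (b' + c') \<in> irr_exps (A, a)"
        using exps_upset_irr_exps[of "(A, a)"] unfolding exps_upset_def by (simp add: lookup_add)
      then show False using not_in z(4) by simp
    qed
    then have "c' \<in> Y" using z(3) by (simp add: Y_def)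
    have "deg b = 0" using b0 by (simp add: deg_def)
    then have "deg b' + deg c' = deg e0"
      using bc(2) z(4) by (metis (mono_tags, lifting) Y0_def add_0 deg_add mem_Collect_eq)
    then have "deg c' = deg e0" "deg b' = 0" using e0(2)[OF \<open>c' \<in> Y\<close>] by auto
    then have "c' \<in> Y0" "b' \<in> X"
      using \<open>c' \<in> Y\<close> z(2) by (auto simp: Y0_def X_def deg_def)
    then show "z \<in> {(b, c)}" using unique z by blast
  next
    fix z assume "z \<in> {(b, c)}"
    then show "z \<in> ?S" using bc by (auto simp: X_def Y0_def Y_def)
  qed
  then have "lookup (f * u) (b + c) = lookup f b * lookup u c"
    unfolding lookup_mult_keys by simp
  moreover have "lookup f b \<noteq> 0" "lookup u c \<noteq> 0"
    using bc by (auto simp: X_def Y0_def Y_def in_keys_iff)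
  ultimately have "b + c \<in> keys (f * u)" by (simp add: in_keys_iff)
  then show False using assms(1) not_in by (simp add: supported_on_def)
qed

text \<open>For exponents 1 the primary property becomes primality.\<close>

lemma prime_ideal_var_ideal: "prime_ideal (var_ideal A :: ('n::finite, 'k::field) mpoly set)"
  unfolding prime_ideal_def
proof (intro conjI allI impI)
  show "ideal (var_ideal A :: ('n, 'k) mpoly set)"
    unfolding var_ideal_def by (rule ideal_supported_on[OF exps_upset_irr_exps])
  have "monomial 0 \<notin> (var_ideal A :: ('n, 'k) mpoly set)" by (simp add: mem_var_ideal)
  then show "var_ideal A \<noteq> (UNIV :: ('n, 'k) mpoly set)" by blast
  show "f \<in> var_ideal A \<or> g \<in> var_ideal A" if "f * g \<in> var_ideal A" for f g :: "('n, 'k) mpoly"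
    using supported_on_irr_exps_primary[of f g A "\<lambda>_. 1"] that unfolding var_ideal_def by blast
qed

text \<open>If \<open>P\<close> is the annihilator of the class of \<open>u\<close>, then
  \<open>u\<close> lies outside some component \<open>p\<close>, and the primary property puts
  \<open>P\<close> inside \<open>var_ideal (fst p)\<close>.\<close>

lemma Ass_subset_var_ideal:
  fixes F :: "('n::finite set \<times> ('n \<Rightarrow> nat)) set"
  assumes "P \<in> Ass (supported_on (\<Inter> (irr_exps ` F)) :: ('n, 'k::field) mpoly set)"
  shows "P \<subseteq> var_ideal (\<Union> (fst ` F))"
proof -
  let ?I = "supported_on (\<Inter> (irr_exps ` F)) :: ('n, 'k) mpoly set"
  obtain u where u: "prime_ideal P" "P = colon ?I u" using assms by (auto simp: Ass_def)
  have "1 \<notin> P"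
    using u(1) ring_module.subspace_scale[of P 1] by (auto simp: prime_ideal_def)
  then have "u \<notin> ?I" by (simp add: u(2) colon_def)
  then obtain p where p: "p \<in> F" "u \<notin> supported_on (irr_exps p)"
    by (auto simp: supported_on_def)
  show ?thesis
  proof
    fix f assume "f \<in> P"
    then have "f * u \<in> ?I" by (simp add: u(2) colon_def)
    then have "f * u \<in> supported_on (irr_exps p)"
      using p(1) by (auto simp: supported_on_def)
    then have "f \<in> var_ideal (fst p)"
      using p(2) supported_on_irr_exps_primary[of f u "fst p" "snd p"] by simp
    moreover have "fst p \<subseteq> \<Union> (fst ` F)" using p(1) by blast
    ultimately show "f \<in> var_ideal (\<Union> (fst ` F))" using var_ideal_mono by blast
  qed
qed

lemma monomial_mult_in_supported_on_iff:
  "(f * monomial u :: ('n, 'k::field) mpoly) \<in> supported_on M \<longleftrightarrow> (\<forall>e\<in>keys f. lookup (u + e) \<in> M)"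
proof
  assume fu: "f * monomial u \<in> supported_on M"
  show "\<forall>e\<in>keys f. lookup (u + e) \<in> M"
  proof
    fix e assume "e \<in> keys f"
    then have "u + e \<in> keys (monomial u * f)" by (simp add: in_keys_iff)
    then show "lookup (u + e) \<in> M" using fu by (simp add: supported_on_def mult.commute)
  qed
next
  assume "\<forall>e\<in>keys f. lookup (u + e) \<in> M"
  then show "f * monomial u \<in> supported_on M"
    using keys_mult[of f "monomial u"] by (fastforce simp: supported_on_def add.commute)
qed

text \<open>If \<open>e\<close> violates only the component \<open>p\<close>, then raising its coordinates in \<open>fst p\<close> to
  their largest values that still violate \<open>p\<close> gives a monomial with annihilator
  \<open>var_ideal (fst p)\<close>.\<close>

lemma var_ideal_in_Ass:
  fixes F :: "('n::finite set \<times> ('n \<Rightarrow> nat)) set"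
  assumes "p \<in> F" "supported_on (\<Inter> (irr_exps ` (F - {p}))) \<noteq>
    (supported_on (\<Inter> (irr_exps ` F)) :: ('n, 'k::field) mpoly set)"
  shows "var_ideal (fst p) \<in> Ass (supported_on (\<Inter> (irr_exps ` F)) :: ('n, 'k) mpoly set)"
proof -
  let ?I = "supported_on (\<Inter> (irr_exps ` F)) :: ('n, 'k) mpoly set"
  \<comment> \<open>Irredundancy provides an exponent that violates \<open>p\<close> and no other
    component.\<close>
  have "\<not> \<Inter> (irr_exps ` (F - {p})) \<subseteq> irr_exps p"
  proof
    assume "\<Inter> (irr_exps ` (F - {p})) \<subseteq> irr_exps p"
    then have "\<Inter> (irr_exps ` (F - {p})) = \<Inter> (irr_exps ` F)" by blast
    then show False using assms(2) by simp
  qed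
  then obtain e where e: "e \<in> \<Inter> (irr_exps ` (F - {p}))" "e \<notin> irr_exps p" by blast
  then have lt: "e k < snd p k" if "k \<in> fst p" for k
    using that by (auto simp: irr_exps_def not_le)
  define u :: "'n \<Rightarrow>\<^sub>0 nat" where
    "u = Abs_poly_mapping (\<lambda>k. if k \<in> fst p then snd p k - 1 else e k)"
  have u: "lookup u k = (if k \<in> fst p then snd p k - 1 else e k)" for k
    by (simp add: u_def Abs_poly_mapping_inverse)
  have "lookup (u + k) \<in> \<Inter> (irr_exps ` F) \<longleftrightarrow> (\<exists>i\<in>fst p. lookup k i \<noteq> 0)" for k
  proof -
    have "e j \<le> lookup (u + k) j" for j using lt[of j] by (auto simp: lookup_add u)
    then have "lookup (u + k) \<in> irr_exps q" if "q \<in> F - {p}" for q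
      using e(1) that exps_upset_irr_exps[of q] unfolding exps_upset_def by blast
    then have "lookup (u + k) \<in> \<Inter> (irr_exps ` F) \<longleftrightarrow> lookup (u + k) \<in> irr_exps p"
      using assms(1) by blast
    also have "\<dots> \<longleftrightarrow> (\<exists>i\<in>fst p. snd p i \<le> snd p i - 1 + lookup k i)"
      by (auto simp: irr_exps_def lookup_add u)
    \<comment> \<open>By \<open>lt\<close>, \<open>snd p i\<close> is positive on
      \<open>fst p\<close>, so the truncated subtraction is exact.\<close>
    also have "\<dots> \<longleftrightarrow> (\<exists>i\<in>fst p. lookup k i \<noteq> 0)"
    proof (intro bex_cong refl)
      fix i assume "i \<in> fst p"
      then show "(snd p i \<le> snd p i - 1 + lookup k i) = (lookup k i \<noteq> 0)"
        using lt[of i] by auto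
    qed
    finally show ?thesis .
  qed
  then have "f \<in> var_ideal (fst p) \<longleftrightarrow> f \<in> colon ?I (monomial u)" for f
    by (simp add: mem_var_ideal colon_def monomial_mult_in_supported_on_iff)
  then have "var_ideal (fst p) = colon ?I (monomial u)" by blast
  then show ?thesis using prime_ideal_var_ideal unfolding Ass_def by blast
qed

text \<open>Asking only for containment covers both \<open>Ass I\<close> and subfamilies made up of
  ideals \<open>var_ideal (fst p)\<close>.\<close>

lemma ideal_sum_eq_var_ideal:
  assumes "\<And>P. P \<in> Ps \<Longrightarrow> P \<subseteq> (var_ideal U :: ('n, 'k::field) mpoly set)"
    and "\<And>i. i \<in> U \<Longrightarrow> \<exists>P\<in>Ps. var i \<in> P"
  shows "ideal_sum Ps = var_ideal U"
proof
  have "ideal (var_ideal U :: ('n, 'k) mpoly set)"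
    unfolding var_ideal_def by (rule ideal_supported_on[OF exps_upset_irr_exps])
  then show "ideal_sum Ps \<subseteq> var_ideal U"
    unfolding ideal_sum_def using assms(1) by (intro ring_module.span_minimal) blast+
  show "var_ideal U \<subseteq> ideal_sum Ps"
    unfolding ideal_sum_def ideal_generated_vars[symmetric]
    using assms(2) by (intro ring_module.span_mono) blast
qed

text \<open>Adding the variables of \<open>U\<close> one at a time gives a chain of primes below any
  prime containing \<open>var_ideal U\<close>. As the height enters the size with a negative sign, a
  lower bound is the direction that matters.\<close>

lemma height_var_ideal_ge:
  "enat (card U) \<le> height (var_ideal U :: ('n::finite, 'k::field) mpoly set)"
  unfolding height_def
proof (rule INF_greatest)
  fix P :: "('n, 'k) mpoly set" assume "P \<in> {P. prime_ideal P \<and> var_ideal U \<subseteq> P}"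
  then have P: "prime_ideal P" "var_ideal U \<subseteq> P" by auto
  obtain h where h: "bij_betw h {0..<card U} U"
    using ex_bij_betw_nat_finite[of U] by auto
  \<comment> \<open>The chain ends in \<open>P\<close> instead of \<open>var_ideal U\<close>; the
    last step is strict because \<open>P\<close> contains the last variable.\<close>
  define C where "C i = (if i < card U then var_ideal (h ` {0..<i}) else P)" for i
  have "C i \<subset> C (Suc i)" if i: "i < card U" for i
  proof -
    have hU: "h ` {0..<j} \<subseteq> U" if "j \<le> card U" for j
      using h that by (auto simp: bij_betw_def)
    have "h i \<notin> h ` {0..<i}"
      using inj_on_image_mem_iff[OF bij_betw_imp_inj_on[OF h], of i "{0..<i}"] i by auto
    then have "var (h i) \<notin> C i" using i by (simp add: C_def)
    moreover have "var_ideal (h ` {0..<Suc i}) \<subseteq> C (Suc i)"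
      using P(2) var_ideal_mono[OF hU[of "Suc i"]] i unfolding C_def by auto
    moreover have "(var (h i) :: ('n, 'k) mpoly) \<in> var_ideal (h ` {0..<Suc i})" by simp
    moreover have "C i \<subseteq> var_ideal (h ` {0..<Suc i})"
      using i var_ideal_mono[of "h ` {0..<i}" "h ` {0..<Suc i}"] by (simp add: C_def image_mono)
    ultimately show ?thesis by blast
  qed
  moreover have "\<forall>i\<le>card U. prime_ideal (C i)" using P(1) prime_ideal_var_ideal by (auto simp: C_def)
  moreover have "C (card U) = P" by (simp add: C_def)
  ultimately show "enat (card U) \<le> prime_height P"
    unfolding prime_height_def by (intro Sup_upper) blast
qed

text \<open>The primes belonging to a cover \<open>H\<close> that extends \<open>G\<close> already
  have the full sum, so the minimal number is at most \<open>card H\<close>.\<close>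

lemma Ass_sum_number_le:
  fixes F :: "('n::finite set \<times> ('n \<Rightarrow> nat)) set"
  defines "I \<equiv> supported_on (\<Inter> (irr_exps ` F)) :: ('n, 'k::field) mpoly set"
  assumes "finite F" "\<And>p. p \<in> F \<Longrightarrow> var_ideal (fst p) \<in> Ass I" "G \<subseteq> F"
  shows "Ass_sum_number I + card (\<Union> (fst ` G)) \<le> card (\<Union> (fst ` F)) + card G"
proof -
  let ?U = "\<Union> (fst ` F)" and ?V = "\<Union> (fst ` G)"
  have "\<forall>x\<in>?U. \<exists>q. q \<in> F \<and> x \<in> fst q" by blast
  then obtain q where q: "\<And>x. x \<in> ?U \<Longrightarrow> q x \<in> F \<and> x \<in> fst (q x)" by metis
  define H where "H = G \<union> q ` (?U - ?V)"
  have "H \<subseteq> F" using assms(4) q unfolding H_def by blast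
  then have "finite H" using assms(2) by (rule finite_subset)
  have "finite G" using assms(4,2) by (rule finite_subset)
  have "?V \<subseteq> ?U" using assms(4) by blast
  have "card H \<le> card G + card (q ` (?U - ?V))" unfolding H_def by (rule card_Un_le)
  also have "\<dots> \<le> card G + card (?U - ?V)" by (simp add: card_image_le)
  also have "card (?U - ?V) = card ?U - card ?V" using \<open>?V \<subseteq> ?U\<close> by (simp add: card_Diff_subset)
  finally have "card H + card ?V \<le> card ?U + card G"
    using card_mono[OF _ \<open>?V \<subseteq> ?U\<close>] by simp
  moreover have "Ass_sum_number I \<le> card H"
    unfolding Ass_sum_number_def
  proof (rule Least_le)
    obtain h where h: "bij_betw h {1..card H} H"
      using ex_bij_betw_nat_finite_1[OF \<open>finite H\<close>] by blast
    have img: "(\<lambda>i. var_ideal (fst (h i)) :: ('n, 'k) mpoly set) ` {1..card H} = (\<lambda>p. var_ideal (fst p)) ` H"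
      using arg_cong[OF bij_betw_imp_surj_on[OF h], of "image (\<lambda>p. var_ideal (fst p))"]
      by (simp only: image_image)
    have "Ass_sum I = var_ideal ?U"
      unfolding Ass_sum_def
    proof (rule ideal_sum_eq_var_ideal)
      show "P \<subseteq> var_ideal ?U" if "P \<in> Ass I" for P
        using Ass_subset_var_ideal that unfolding I_def by blast
      show "\<exists>P\<in>Ass I. var i \<in> P" if "i \<in> ?U" for i
        using assms(3) q[OF that] by (intro bexI[of _ "var_ideal (fst (q i))"]) simp_all
    qed
    moreover have "ideal_sum ((\<lambda>p. var_ideal (fst p)) ` H) = (var_ideal ?U :: ('n, 'k) mpoly set)"
    proof (rule ideal_sum_eq_var_ideal)
      fix P :: "('n, 'k) mpoly set" assume "P \<in> (\<lambda>p. var_ideal (fst p)) ` H"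
      then obtain p where p: "p \<in> H" "P = var_ideal (fst p)" by blast
      have "fst p \<subseteq> ?U" using p(1) \<open>H \<subseteq> F\<close> by blast
      then show "P \<subseteq> var_ideal ?U" unfolding p(2) by (rule var_ideal_mono)
    next
      fix i assume i: "i \<in> ?U"
      have "\<exists>p\<in>H. i \<in> fst p"
      proof (cases "i \<in> ?V")
        case True
        then show ?thesis by (auto simp: H_def)
      next
        case False
        then show ?thesis using i q[OF i] by (intro bexI[of _ "q i"]) (auto simp: H_def)
      qed
      then show "\<exists>P\<in>(\<lambda>p. var_ideal (fst p)) ` H. (var i :: ('n, 'k) mpoly) \<in> P" by auto
    qed
    moreover have "(\<lambda>p. var_ideal (fst p)) ` H \<subseteq> Ass I" using assms(3) \<open>H \<subseteq> F\<close> by blast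
    ultimately show "\<exists>P. P ` {1..card H} \<subseteq> Ass I \<and> ideal_sum (P ` {1..card H}) = Ass_sum I"
      by (intro exI[of _ "\<lambda>i. var_ideal (fst (h i))"]) (simp only: img)
  qed
  ultimately show ?thesis by linarith
qed

section \<open>Comparison of the cone dimensions with the size\<close>

theorem theorem22:
  fixes I :: "('n::finite, 'k::field) mpoly set"
    and Q P :: "nat \<Rightarrow> ('n, 'k) mpoly set"
    and s :: nat
  assumes "monomial_ideal I" and "I \<noteq> {0}" and "I \<noteq> UNIV"
    and "\<And>i. i \<in> {1..s} \<Longrightarrow> irreducible_monomial_ideal (Q i)"
    and "I = (\<Inter>i\<in>{1..s}. Q i)"
    and "\<And>j. j \<in> {1..s} \<Longrightarrow> (\<Inter>i\<in>{1..s} - {j}. Q i) \<noteq> I"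
    and "\<And>i. i \<in> {1..s} \<Longrightarrow> P i = radical (Q i)"
  shows "ereal (real (sdepth I {0})) \<ge> ideal_size I + 1"
proof -
  have "\<exists>p. Q i = supported_on (irr_exps p)" if "i \<in> {1..s}" for i
    using assms(4)[OF that] ideal_generated_var_powers unfolding irreducible_monomial_ideal_def by metis
  then obtain p where p: "\<And>i. i \<in> {1..s} \<Longrightarrow> Q i = supported_on (irr_exps (p i))" by metis
  define F where "F = p ` {1..s}"
  define M where "M = \<Inter> (irr_exps ` F)"
  have I: "I = supported_on M"
    using assms(5) p by (simp add: M_def F_def supported_on_INT image_image)
  have Ass: "var_ideal (fst q) \<in> Ass I" if "q \<in> F" for q
  proof -
    obtain j where j: "j \<in> {1..s}" "q = p j" using \<open>q \<in> F\<close> by (auto simp: F_def)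
    \<comment> \<open>Several indices may share \<open>q\<close>, and \<open>F - {q}\<close> drops
      them all. The intersection over the indices other than \<open>j\<close> is then contained in
      this one, so irredundancy at \<open>j\<close> applies.\<close>
    have "supported_on (\<Inter> (irr_exps ` (F - {q}))) \<noteq> I"
    proof
      assume eq: "supported_on (\<Inter> (irr_exps ` (F - {q}))) = I"
      have "(\<Inter>i\<in>{1..s} - {j}. Q i) = (\<Inter>i\<in>{1..s} - {j}. supported_on (irr_exps (p i)))"
        using p by simp
      also have "\<dots> \<subseteq> supported_on (\<Inter> (irr_exps ` (F - {q})))"
        unfolding supported_on_INT by (auto simp: F_def j(2))
      finally have "(\<Inter>i\<in>{1..s} - {j}. Q i) = I" using eq assms(5) by blast
      then show False using assms(6) j(1) by blast
    qed
    then show ?thesis using that var_ideal_in_Ass unfolding I M_def by blast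
  qed
  define U where "U = \<Union> (fst ` F)"
  define r where "r = Ass_sum_number I"
  \<comment> \<open>This is the size plus 1 with the height replaced by its lower bound
    \<open>card U\<close>; the truncated subtraction is exact.\<close>
  define d where "d = CARD('n) - card U + r"
  have "card U \<le> CARD('n)" by (simp add: card_mono)
  have "finite F" by (simp add: F_def)
  have "d + card (\<Union> (fst ` G)) \<le> CARD('n) + card G" if "G \<subseteq> F" for G
  proof -
    have "r + card (\<Union> (fst ` G)) \<le> card U + card G"
      unfolding r_def U_def I M_def
      by (rule Ass_sum_number_le[OF \<open>finite F\<close> Ass[unfolded I M_def] that])
    then show ?thesis using \<open>card U \<le> CARD('n)\<close> by (simp add: d_def)
  qed
  then obtain D where D: "cone_partition D (cone (\<lambda>_. 0, UNIV) \<inter> M)" "\<forall>q\<in>D. d \<le> card (snd q)"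
    using cone_partition_Inter_irr_exps[of F UNIV d "\<lambda>_. 0"] \<open>finite F\<close> unfolding M_def by blast
  have "cone (\<lambda>_. 0, UNIV) \<inter> M = M" by (auto simp: cone_def)
  then have "stanley_decomposition I {0} ((\<lambda>q. (monomial (Abs_poly_mapping (fst q)), snd q)) ` D)"
    using stanley_decomposition_of_cone_partition(1)[of D M] D(1) by (simp add: I)
  moreover have "d \<le> card (snd z)"
    if "z \<in> (\<lambda>q. (monomial (Abs_poly_mapping (fst q)) :: ('n, 'k) mpoly, snd q)) ` D" for z
    using that D(2) by (metis (no_types, lifting) imageE snd_conv)
  moreover have "0 \<in> I" by (simp add: I supported_on_def)
  ultimately have "d \<le> sdepth I {0}" using assms(2) by (intro sdepth_ge)
  have "Ass_sum I = var_ideal U"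
    unfolding Ass_sum_def
  proof (rule ideal_sum_eq_var_ideal)
    show "P \<subseteq> var_ideal U" if "P \<in> Ass I" for P
      using Ass_subset_var_ideal that unfolding I M_def U_def by blast
    show "\<exists>P\<in>Ass I. var i \<in> P" if i: "i \<in> U" for i
    proof -
      obtain q where "q \<in> F" "i \<in> fst q" using i unfolding U_def by blast
      then show ?thesis using Ass by (intro bexI[of _ "var_ideal (fst q)"]) simp_all
    qed
  qed
  then have h: "enat (card U) \<le> height (Ass_sum I)" by (simp add: height_var_ideal_ge)
  show ?thesis
  proof (cases "height (Ass_sum I)")
    case (enat h')
    then have "card U \<le> h'" using h by simp
    then have "real CARD('n) - real h' + real r \<le> real (sdepth I {0})"
      using \<open>d \<le> sdepth I {0}\<close> \<open>card U \<le> CARD('n)\<close> unfolding d_def by linarith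
    then show ?thesis by (simp add: ideal_size_def enat r_def one_ereal_def)
  next
    \<comment> \<open>Here the size is minus infinity and the inequality is trivial.\<close>
    case infinity
    then show ?thesis by (simp add: ideal_size_def one_ereal_def)
  qed
qed

end
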